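(* Let $\Omega\subset\mathbb R^N$, $N\ge2$, be an open, bounded, connected Lipschitz domain, let $\ell\ge1$, let $p_1,\dots,p_\ell:\overline\Omega\to(1,\infty)$, and put $p(x)=\max\{p_1(x),\dots,p_\ell(x)\}$, $p^-=\min_{\overline\Omega}p$, $p'(x)=\frac{p(x)}{p(x)-1}$. Assume that either $p_1,\dots,p_\ell$ are continuous and $p^->\frac{2N}{N+2}$, or $p_1,\dots,p_\ell$ are log-Hölder continuous and $p^-\ge\frac{2N}{N+2}$. Let $w_1,\dots,w_\ell\in L^\infty(\Omega)$ and suppose there is a constant $\omega>0$ with $\min_{1\le j\le\ell}\operatorname{ess\,inf}_{x\in\Omega}w_j(x)\ge\omega$ (fix measurable representatives of the $w_j$, defined on $\overline\Omega$, with values in $[\omega,\infty)$). Define $$\Psi(x,s)=\sum_{j=1}^\ell w_j(x)s^{p_j(x)-2}\quad(x\in\overline\Omega,\ s>0),$$ so that $\mathbf a(x,\xi):=\Psi(x,|\xi|)\xi=\sum_{j=1}^\ell w_j(x)|\xi|^{p_j(x)-2}\xi$ for $\xi\neq0$, $\mathbf a(x,0)=0$; and put $\Phi(x,s)=\Psi(x,|s|)|s|$ for $s\ne0$, $\Phi(x,0)=0$, and $A(x,\xi)=\int_0^{|\xi|}\Phi(x,s)\,ds$. Then: (i) $p:\overline\Omega\to(1,\infty)$ is either log-Hölder continuous with $p^-\ge\frac{2N}{N+2}$, or continuous with $p^->\frac{2N}{N+2}$; (ii) $\Psi$ takes values in $(0,\infty)$, $\Psi(\cdot,s)$ is measurable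 for each $s>0$, and $\Psi(x,\cdot)$ is locally absolutely continuous on $(0,\infty)$ for a.a. $x\in\Omega$; (iii) $\lim_{s\to0^+}\Psi(x,s)s=0$ for each $x\in\Omega$; (iv) for a.a. $x\in\Omega$ the function $(0,\infty)\ni s\mapsto\Psi(x,s)s$ is strictly increasing; (v) for every $v\in L^{p(x)}(\Omega)$ one has $\Phi(\cdot,v(\cdot))\in L^{p'(x)}(\Omega)$; (vi) there are constants $\delta>0$ and $\tilde\delta\ge0$ such that $\int_\Omega A(x,\nabla v(x))\,dx\ge\delta\int_\Omega|\nabla v(x)|^{p(x)}dx-\tilde\delta$ for all $v\in W^{1,p(x)}(\Omega)$.
   Context: For a measurable bounded $q:\Omega\to[1,\infty)$, $L^{q(x)}(\Omega)$ is the space of measurable $u:\Omega\to\mathbb R$ with $\int_\Omega|u(x)|^{q(x)}dx<\infty$, and $W^{1,q(x)}(\Omega)=\{u\in L^{q(x)}(\Omega):|\nabla u|\in L^{q(x)}(\Omega)\}$ (weak gradient). A function $q:\overline\Omega\to\mathbb R$ is log-Hölder continuous if there is $C>0$ with $|q(x)-q(y)|\le C/(-\log|x-y|)$ whenever $x,y\in\overline\Omega$, $0<|x-y|<1/2$. *)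

theory Defs
  imports "HOL-Analysis.Analysis" "HOL-Probability.Essential_Supremum"
begin

section \<open>Lipschitz domains\<close>

text \<open>
  Near each boundary point \<open>\<Omega>\<close> is, in suitable rotated coordinates, the strict epigraph of a
  Lipschitz function of \<open>N - 1\<close> variables. The unit vector \<open>e\<close> is the vertical direction, and
  \<open>y - (y \<bullet> e) *\<^sub>R e\<close> is the projection of \<open>y\<close> to the hyperplane orthogonal to \<open>e\<close>.
\<close>

definition lipschitz_boundary :: "'a::euclidean_space set \<Rightarrow> bool" where
  "lipschitz_boundary \<Omega> \<longleftrightarrow>
     (\<forall>x0 \<in> frontier \<Omega>. \<exists>r>0. \<exists>e. \<exists>L. \<exists>\<gamma> :: 'a \<Rightarrow> real.
        norm e = 1 \<and> L-lipschitz_on {z. z \<bullet> e = 0} \<gamma> \<and>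
        \<Omega> \<inter> ball x0 r = {y \<in> ball x0 r. y \<bullet> e > \<gamma> (y - (y \<bullet> e) *\<^sub>R e)})"

definition bounded_lipschitz_domain :: "'a::euclidean_space set \<Rightarrow> bool" where
  "bounded_lipschitz_domain \<Omega> \<longleftrightarrow>
     open \<Omega> \<and> bounded \<Omega> \<and> connected \<Omega> \<and> \<Omega> \<noteq> {} \<and> lipschitz_boundary \<Omega>"

section \<open>Regularity of functions\<close>

definition log_holder_on :: "'a::metric_space set \<Rightarrow> ('a \<Rightarrow> real) \<Rightarrow> bool" where
  "log_holder_on S q \<longleftrightarrow>
     (\<exists>C>0. \<forall>x\<in>S. \<forall>y\<in>S. 0 < dist x y \<and> dist x y < 1/2 \<longrightarrow>
        \<bar>q x - q y\<bar> \<le> C / (- ln (dist x y)))"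

text \<open>
  A finite family of non-overlapping subintervals of \<open>{a..b}\<close> is a finite set of pairs of end
  points; degenerate pairs contribute nothing to either sum.
\<close>

definition abs_continuous_on_interval :: "real \<Rightarrow> real \<Rightarrow> (real \<Rightarrow> real) \<Rightarrow> bool" where
  "abs_continuous_on_interval a b f \<longleftrightarrow>
     (\<forall>\<epsilon>>0. \<exists>\<delta>>0. \<forall>D :: (real \<times> real) set.
        finite D \<and>
        (\<forall>(c, d) \<in> D. a \<le> c \<and> c \<le> d \<and> d \<le> b) \<and>
        pairwise (\<lambda>I J. {fst I<..<snd I} \<inter> {fst J<..<snd J} = {}) D \<and>
        (\<Sum>(c, d)\<in>D. d - c) < \<delta> \<longrightarrow>
        (\<Sum>(c, d)\<in>D. \<bar>f d - f c\<bar>) < \<epsilon>)"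

definition locally_abs_continuous_pos :: "(real \<Rightarrow> real) \<Rightarrow> bool" where
  "locally_abs_continuous_pos f \<longleftrightarrow>
     (\<forall>a b. 0 < a \<and> a \<le> b \<longrightarrow> abs_continuous_on_interval a b f)"

primrec Ck :: "nat \<Rightarrow> ('a::euclidean_space \<Rightarrow> real) \<Rightarrow> bool" where
  "Ck 0 f \<longleftrightarrow> continuous_on UNIV f"
| "Ck (Suc k) f \<longleftrightarrow>
     f differentiable_on UNIV \<and> (\<forall>i\<in>Basis. Ck k (\<lambda>x. frechet_derivative f (at x) i))"

definition test_functions :: "'a::euclidean_space set \<Rightarrow> ('a \<Rightarrow> real) set" where
  "test_functions \<Omega> =
     {\<phi>. (\<forall>k. Ck k \<phi>) \<and> compact (closure {x. \<phi> x \<noteq> 0}) \<and> closure {x. \<phi> x \<noteq> 0} \<subseteq> \<Omega>}"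

section \<open>Function spaces\<close>

text \<open>
  Elements of the spaces are functions on the whole space of which only the restriction to
  \<open>\<Omega>\<close> matters; functions equal almost everywhere are not identified.
\<close>

definition essinf :: "'a measure \<Rightarrow> ('a \<Rightarrow> ereal) \<Rightarrow> ereal" where
  "essinf M f = - esssup M (\<lambda>x. - f x)"

definition Linf :: "'a::euclidean_space set \<Rightarrow> ('a \<Rightarrow> real) set" where
  "Linf \<Omega> = {u. u \<in> borel_measurable (lebesgue_on \<Omega>) \<and>
                esssup (lebesgue_on \<Omega>) (\<lambda>x. ereal \<bar>u x\<bar>) < \<infinity>}"

definition Lvar :: "'a::euclidean_space set \<Rightarrow> ('a \<Rightarrow> real) \<Rightarrow> ('a \<Rightarrow> real) set" where
  "Lvar \<Omega> q = {u. u \<in> borel_measurable (lebesgue_on \<Omega>) \<and>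
                  integrable (lebesgue_on \<Omega>) (\<lambda>x. \<bar>u x\<bar> powr q x)}"

definition locally_integrable ::
    "'a::euclidean_space set \<Rightarrow> ('a \<Rightarrow> 'b::euclidean_space) \<Rightarrow> bool" where
  "locally_integrable \<Omega> f \<longleftrightarrow> (\<forall>K. compact K \<and> K \<subseteq> \<Omega> \<longrightarrow> f absolutely_integrable_on K)"

definition is_weak_grad ::
    "'a::euclidean_space set \<Rightarrow> ('a \<Rightarrow> real) \<Rightarrow> ('a \<Rightarrow> 'a) \<Rightarrow> bool" where
  "is_weak_grad \<Omega> u g \<longleftrightarrow>
     locally_integrable \<Omega> u \<and> locally_integrable \<Omega> g \<and>
     (\<forall>\<phi> \<in> test_functions \<Omega>. \<forall>i\<in>Basis.
        (LINT x|lebesgue_on \<Omega>. u x * frechet_derivative \<phi> (at x) i) =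
        - (LINT x|lebesgue_on \<Omega>. (g x \<bullet> i) * \<phi> x))"

text \<open>
  The weak gradient is unique up to null sets, so the choice of a representative is immaterial.
\<close>

definition weak_grad :: "'a::euclidean_space set \<Rightarrow> ('a \<Rightarrow> real) \<Rightarrow> 'a \<Rightarrow> 'a" where
  "weak_grad \<Omega> u = (SOME g. is_weak_grad \<Omega> u g)"

definition W1var :: "'a::euclidean_space set \<Rightarrow> ('a \<Rightarrow> real) \<Rightarrow> ('a \<Rightarrow> real) set" where
  "W1var \<Omega> q = {u \<in> Lvar \<Omega> q. (\<exists>g. is_weak_grad \<Omega> u g) \<and>
                             (\<lambda>x. norm (weak_grad \<Omega> u x)) \<in> Lvar \<Omega> q}"

section \<open>Exponents and the operator\<close>

definition max_exponent :: "nat \<Rightarrow> (nat \<Rightarrow> 'a \<Rightarrow> real) \<Rightarrow> 'a \<Rightarrow> real" where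
  "max_exponent l ps x = Max ((\<lambda>j. ps j x) ` {1..l})"

text \<open>For continuous \<open>p\<close> and compact \<open>closure \<Omega>\<close> the infimum is attained, i.e. a minimum.\<close>

definition lower_exponent :: "'a::topological_space set \<Rightarrow> ('a \<Rightarrow> real) \<Rightarrow> real" where
  "lower_exponent \<Omega> p = (INF x\<in>closure \<Omega>. p x)"

definition conj_exponent :: "('a \<Rightarrow> real) \<Rightarrow> 'a \<Rightarrow> real" where
  "conj_exponent p x = p x / (p x - 1)"

definition Psi ::
    "nat \<Rightarrow> (nat \<Rightarrow> 'a \<Rightarrow> real) \<Rightarrow> (nat \<Rightarrow> 'a \<Rightarrow> real) \<Rightarrow> 'a \<Rightarrow> real \<Rightarrow> real" where
  "Psi l w ps x s = (\<Sum>j=1..l. w j x * s powr (ps j x - 2))"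

definition Phi :: "('a \<Rightarrow> real \<Rightarrow> real) \<Rightarrow> 'a \<Rightarrow> real \<Rightarrow> real" where
  "Phi \<psi> x s = (if s = 0 then 0 else \<psi> x \<bar>s\<bar> * \<bar>s\<bar>)"

definition potential ::
    "('a \<Rightarrow> real \<Rightarrow> real) \<Rightarrow> 'a \<Rightarrow> 'b::real_normed_vector \<Rightarrow> real" where
  "potential \<psi> x \<xi> = (LINT s:{0..norm \<xi>}|lborel. Phi \<psi> x s)"

end

theory Submission
  imports Defs
begin

text \<open>
  Everything rests on the identities \<open>\<Psi>(x,s) s = \<Sum>\<^sub>j w\<^sub>j s\<^bsup>p\<^sub>j-1\<^esup>\<close> and
  \<open>A(x,\<xi>) = \<Sum>\<^sub>j w\<^sub>j |\<xi>|\<^bsup>p\<^sub>j\<^esup> / p\<^sub>j\<close>. By compactness of the closure of \<open>\<Omega>\<close>, \<open>p\<close> takes values in some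
  \<open>[m, M]\<close> with \<open>m > 1\<close>. With \<open>w\<^sub>j \<le> K\<close> almost everywhere, both sums are dominated through
  \<open>s\<^sup>a \<le> (max 1 s)\<^sup>b\<close> for \<open>0 \<le> a \<le> b\<close>, which gives (v) and the integrability in (vi). Keeping only the
  summand with \<open>p\<^sub>j = p\<close> gives \<open>A(x,\<xi>) \<ge> (\<omega>/M) |\<xi>|\<^sup>p\<close>, so no additive constant is needed in (vi).
\<close>

section \<open>The maximal exponent\<close>

text \<open>The maximum changes by no more than the two arguments change together, so the
  log-Hoelder constants add.\<close>

lemma log_holder_on_max:
  assumes "log_holder_on S f" "log_holder_on S g"
  shows "log_holder_on S (\<lambda>x. max (f x) (g x))"
proof -
  obtain C D where C: "C > 0" "\<And>x y. x \<in> S \<Longrightarrow> y \<in> S \<Longrightarrow> 0 < dist x y \<Longrightarrow> dist x y < 1/2 \<Longrightarrow>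
        \<bar>f x - f y\<bar> \<le> C / (- ln (dist x y))"
    and D: "D > 0" "\<And>x y. x \<in> S \<Longrightarrow> y \<in> S \<Longrightarrow> 0 < dist x y \<Longrightarrow> dist x y < 1/2 \<Longrightarrow>
        \<bar>g x - g y\<bar> \<le> D / (- ln (dist x y))"
    using assms unfolding log_holder_on_def by metis
  have "\<bar>max (f x) (g x) - max (f y) (g y)\<bar> \<le> (C + D) / (- ln (dist x y))"
    if "x \<in> S" "y \<in> S" "0 < dist x y" "dist x y < 1/2" for x y
  proof -
    have "\<bar>max (f x) (g x) - max (f y) (g y)\<bar> \<le> \<bar>f x - f y\<bar> + \<bar>g x - g y\<bar>" by linarith
    also have "\<dots> \<le> C / (- ln (dist x y)) + D / (- ln (dist x y))"
      using C(2)[OF that] D(2)[OF that] by linarith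
    finally show ?thesis by (simp add: add_divide_distrib)
  qed
  then show ?thesis
    unfolding log_holder_on_def using C(1) D(1) by (intro exI[of _ "C + D"]) auto
qed

text \<open>The modulus C / (- ln t) tends to 0 as t decreases to 0. This lets both regularity
  alternatives be handled through continuity wherever compactness or measurability is
  needed.\<close>

lemma log_holder_on_imp_continuous_on:
  assumes "log_holder_on S f"
  shows "continuous_on S f"
proof -
  obtain C where C: "C > 0" "\<And>x y. x \<in> S \<Longrightarrow> y \<in> S \<Longrightarrow> 0 < dist x y \<Longrightarrow> dist x y < 1/2 \<Longrightarrow>
        \<bar>f x - f y\<bar> \<le> C / (- ln (dist x y))"
    using assms unfolding log_holder_on_def by metis
  \<comment> \<open>At distance exp (- C / e) the modulus equals e, and below it is smaller; 1/2 is
    the range in which the log-Hoelder estimate is available.\<close>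
  have "dist (f y) (f x) < e"
    if "x \<in> S" "y \<in> S" "e > 0" "dist y x < min (1/2) (exp (- C / e))" for x y e
  proof (cases "y = x")
    case False
    then have pos: "0 < dist x y" by simp
    have d: "dist x y < 1/2" "dist x y < exp (- C / e)"
      using that(4) by (auto simp: dist_commute)
    have "ln (dist x y) < - C / e"
      using pos d(2) by (metis ln_exp ln_less_cancel_iff exp_gt_zero)
    then have L: "C / e < - ln (dist x y)" by simp
    then have "0 < - ln (dist x y)" using C(1) that(3) by (meson divide_pos_pos less_trans)
    with L that(3) have "C / (- ln (dist x y)) < e" by (simp add: field_simps)
    then show ?thesis
      using C(2)[OF that(1,2) pos d(1)] by (simp add: dist_real_def abs_minus_commute)
  qed (use that in auto)
  then show ?thesis
    unfolding continuous_on_iff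
    by (metis divide_pos_pos exp_gt_zero min_less_iff_conj zero_less_numeral zero_less_one)
qed

text \<open>The predicate \<open>P\<close> will be continuity and log-Hoelder continuity. The
  induction starts at 1, since the maximum over an empty index set has no specified value.\<close>

lemma max_exponent_closed:
  assumes "l \<ge> 1" "\<And>f g. P f \<Longrightarrow> P g \<Longrightarrow> P (\<lambda>x. max (f x) (g x))" "\<And>j. j \<in> {1..l} \<Longrightarrow> P (ps j)"
  shows "P (max_exponent l ps)"
  using assms(1,3)
proof (induction l rule: dec_induct)
  case base
  have "max_exponent 1 ps = ps 1" by (auto simp: max_exponent_def)
  then show ?case using base by auto
next
  case (step n)
  have "max_exponent (Suc n) ps = (\<lambda>x. max (ps (Suc n) x) (max_exponent n ps x))"
  proof
    fix x
    have "{1..Suc n} = insert (Suc n) {1..n}" by auto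
    then show "max_exponent (Suc n) ps x = max (ps (Suc n) x) (max_exponent n ps x)"
      unfolding max_exponent_def using step.hyps by (simp del: atLeastAtMost_iff)
  qed
  then show ?case using step assms(2) by auto
qed

lemma max_exponent_ge: "j \<in> {1..l} \<Longrightarrow> ps j x \<le> max_exponent l ps x"
  unfolding max_exponent_def by (intro Max_ge) auto

lemma max_exponent_attained:
  assumes "l \<ge> 1"
  obtains j where "j \<in> {1..l}" "max_exponent l ps x = ps j x"
proof -
  have "Max ((\<lambda>j. ps j x) ` {1..l}) \<in> (\<lambda>j. ps j x) ` {1..l}"
    using assms by (intro Max_in) auto
  then show ?thesis using that unfolding max_exponent_def by auto
qed

section \<open>The nonlinearity\<close>

lemma Psi_times:
  assumes "s \<ge> 0"
  shows "Psi l w ps x s * s = (\<Sum>j=1..l. w j x * s powr (ps j x - 1))"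
\<comment> \<open>At \<open>s = 0\<close> both sides vanish because \<open>0 powr a = 0\<close> for
  every \<open>a\<close>; hence the closed formula for \<open>Phi\<close> below needs no case
  distinction.\<close>
proof (cases "s = 0")
  case False
  then have "s powr (q - 2) * s = s powr (q - 1)" for q
    using powr_mult_base[OF assms, of "q - 2"] by (simp add: mult.commute)
  then show ?thesis unfolding Psi_def by (simp add: sum_distrib_right mult.assoc)
qed auto

lemma Phi_Psi: "Phi (Psi l w ps) x s = (\<Sum>j=1..l. w j x * \<bar>s\<bar> powr (ps j x - 1))"
  using Psi_times[of "\<bar>s\<bar>" l w ps x] by (auto simp: Phi_def)

lemma set_integral_sum:
  fixes f :: "'i \<Rightarrow> 'a \<Rightarrow> 'b::{banach, second_countable_topology}"
  assumes "\<And>i. i \<in> I \<Longrightarrow> set_integrable M A (f i)"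
  shows "(LINT x:A|M. \<Sum>i\<in>I. f i x) = (\<Sum>i\<in>I. LINT x:A|M. f i x)"
  using assms unfolding set_lebesgue_integral_def set_integrable_def
  by (simp add: scaleR_sum_right)

lemma potential_Psi:
  assumes "\<And>j. j \<in> {1..l} \<Longrightarrow> ps j x > 1"
  shows "potential (Psi l w ps) x \<xi> = (\<Sum>j=1..l. w j x * norm \<xi> powr ps j x / ps j x)"
proof -
  \<comment> \<open>Since q - 1 > 0 the integrand is continuous up to 0, so it is Lebesgue
    integrable on the compact interval; its value is then taken over from the gauge
    integral.\<close>
  have *: "set_integrable lborel {0..norm \<xi>} (\<lambda>s. s powr (q - 1)) \<and>
        (LINT s:{0..norm \<xi>}|lborel. s powr (q - 1)) = norm \<xi> powr q / q" if "q > 1" for q :: real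
  proof -
    have hi: "((\<lambda>s. s powr (q - 1)) has_integral (norm \<xi> powr q / q)) {0..norm \<xi>}"
      using has_integral_powr_from_0[of "q - 1" "norm \<xi>"] that by simp
    have "continuous_on {0..norm \<xi>} (\<lambda>s. s powr (q - 1))"
      using that by (intro continuous_on_powr') (auto intro!: continuous_intros)
    then have "set_integrable lborel {0..norm \<xi>} (\<lambda>s. s powr (q - 1))"
      unfolding set_integrable_def by (intro borel_integrable_compact) auto
    then show ?thesis
      using hi set_borel_integral_eq_integral(2) integral_unique by metis
  qed
  have "potential (Psi l w ps) x \<xi> =
      (LINT s:{0..norm \<xi>}|lborel. \<Sum>j=1..l. w j x * s powr (ps j x - 1))"
    unfolding potential_def Phi_Psi by (intro set_lebesgue_integral_cong) auto
  also have "\<dots> = (\<Sum>j=1..l. LINT s:{0..norm \<xi>}|lborel. w j x * s powr (ps j x - 1))"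
    using * assms by (intro set_integral_sum) auto
  also have "\<dots> = (\<Sum>j=1..l. w j x * norm \<xi> powr ps j x / ps j x)"
    using * assms by (intro sum.cong) auto
  finally show ?thesis .
qed

section \<open>Local absolute continuity, limit at zero and monotonicity\<close>

lemma abs_continuous_on_interval_lipschitz:
  assumes "L-lipschitz_on {a..b} f"
  shows "abs_continuous_on_interval a b f"
  unfolding abs_continuous_on_interval_def
proof (intro allI impI)
  fix e :: real assume e: "e > 0"
  have L: "L \<ge> 0" using assms by (rule lipschitz_on_nonneg)
  show "\<exists>\<delta>>0. \<forall>D. finite D \<and> (\<forall>(c, d)\<in>D. a \<le> c \<and> c \<le> d \<and> d \<le> b) \<and>
       pairwise (\<lambda>I J. {fst I<..<snd I} \<inter> {fst J<..<snd J} = {}) D \<and> (\<Sum>(c, d)\<in>D. d - c) < \<delta> \<longrightarrow>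
       (\<Sum>(c, d)\<in>D. \<bar>f d - f c\<bar>) < e"
  \<comment> \<open>The summand 1 covers \<open>L = 0\<close> and makes the final estimate L e / (L
    + 1) < e strict.\<close>
  proof (intro exI[of _ "e / (L + 1)"] conjI allI impI, goal_cases)
    case (2 D)
    have "(\<Sum>(c, d)\<in>D. \<bar>f d - f c\<bar>) \<le> (\<Sum>(c, d)\<in>D. L * (d - c))"
    proof (intro sum_mono, clarify)
      fix c d assume "(c, d) \<in> D"
      then have "a \<le> c" "c \<le> d" "d \<le> b" using 2 by auto
      then show "\<bar>f d - f c\<bar> \<le> L * (d - c)"
        using lipschitz_onD[OF assms, of d c] by (auto simp: dist_real_def)
    qed
    also have "\<dots> = L * (\<Sum>(c, d)\<in>D. d - c)" by (simp add: sum_distrib_left case_prod_unfold)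
    also have "\<dots> \<le> L * (e / (L + 1))" using 2 L by (intro mult_left_mono) auto
    also have "\<dots> < e" using L e by (simp add: field_simps)
    finally show ?case .
  qed (use e L in auto)
qed

text \<open>On \<open>{a..b}\<close> with a > 0 all powers are continuously differentiable, whatever
  the sign of the exponent, so the derivative is bounded there and \<open>Psi\<close> is
  Lipschitz.\<close>

lemma locally_abs_continuous_pos_Psi: "locally_abs_continuous_pos (Psi l w ps x)"
  unfolding locally_abs_continuous_pos_def
proof (intro allI impI)
  fix a b :: real assume ab: "0 < a \<and> a \<le> b"
  let ?f' = "\<lambda>s. \<Sum>j=1..l. w j x * ((ps j x - 2) * s powr (ps j x - 2 - 1))"
  have der: "(Psi l w ps x has_field_derivative ?f' s) (at s within {a..b})" if "s \<in> {a..b}" for s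
    unfolding Psi_def using that ab
    by (intro DERIV_sum DERIV_cmult has_field_derivative_at_within[OF has_real_derivative_powr]) auto
  have "continuous_on {a..b} ?f'"
    using ab by (intro continuous_intros) auto
  then have "bounded (?f' ` {a..b})"
    by (intro compact_imp_bounded compact_continuous_image) auto
  then obtain B where B: "B > 0" "\<And>s. s \<in> {a..b} \<Longrightarrow> norm (?f' s) \<le> B"
    unfolding bounded_pos by blast
  have "B-lipschitz_on {a..b} (Psi l w ps x)"
  proof (rule lipschitz_onI)
    fix s t assume "s \<in> {a..b}" "t \<in> {a..b}"
    then show "dist (Psi l w ps x s) (Psi l w ps x t) \<le> B * dist s t"
      unfolding dist_norm
      by (intro field_differentiable_bound[where S = "{a..b}" and f' = ?f'] der B(2)) auto
  qed (use B in auto)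
  then show "abs_continuous_on_interval a b (Psi l w ps x)"
    by (rule abs_continuous_on_interval_lipschitz)
qed

text \<open>\<open>Psi\<close> itself may blow up at 0 when some exponent is below 2; the extra
  factor \<open>s\<close> leaves only the positive exponents \<open>ps j x - 1\<close>.\<close>

lemma Psi_times_tendsto_0:
  assumes "\<And>j. j \<in> {1..l} \<Longrightarrow> ps j x > 1"
  shows "((\<lambda>s. Psi l w ps x s * s) \<longlongrightarrow> 0) (at_right 0)"
proof -
  have "((\<lambda>s. \<Sum>j=1..l. w j x * s powr (ps j x - 1)) \<longlongrightarrow>
      (\<Sum>j=1..l. w j x * 0 powr (ps j x - 1))) (at_right 0)"
    using assms
    by (intro tendsto_sum tendsto_mult_left tendsto_powr' tendsto_ident_at tendsto_const)
       (auto simp: eventually_at_filter)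
  then have "((\<lambda>s. \<Sum>j=1..l. w j x * s powr (ps j x - 1)) \<longlongrightarrow> 0) (at_right 0)" by simp
  moreover have "\<forall>\<^sub>F s in at_right 0. (\<Sum>j=1..l. w j x * s powr (ps j x - 1)) = Psi l w ps x s * s"
    by (auto simp: eventually_at_filter Psi_times)
  ultimately show ?thesis using tendsto_cong by force
qed

lemma Psi_pos:
  assumes "l \<ge> 1" "\<And>j. j \<in> {1..l} \<Longrightarrow> w j x > 0" "s > 0"
  shows "Psi l w ps x s > 0"
  unfolding Psi_def using assms by (intro sum_pos) auto

lemma strict_mono_on_Psi_times:
  assumes "l \<ge> 1" "\<And>j. j \<in> {1..l} \<Longrightarrow> w j x > 0" "\<And>j. j \<in> {1..l} \<Longrightarrow> ps j x > 1"
  shows "strict_mono_on {0<..} (\<lambda>s. Psi l w ps x s * s)"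
proof (rule strict_mono_onI)
  fix r s :: real assume "r \<in> {0<..}" "s \<in> {0<..}" "r < s"
  then show "Psi l w ps x r * r < Psi l w ps x s * s"
    using assms by (auto simp: Psi_times intro!: sum_strict_mono mult_strict_left_mono powr_less_mono2)
qed

section \<open>Growth\<close>

text \<open>For s < 1 raising the exponent lowers the power. The base \<open>max 1 s\<close>
  restores monotonicity in the exponent, so different exponents can be compared for all
  \<open>s\<close>.\<close>

lemma powr_le_max_1_powr:
  fixes s a b :: real
  assumes "s \<ge> 0" "0 \<le> a" "a \<le> b"
  shows "s powr a \<le> max 1 s powr b"
proof -
  have "s powr a \<le> max 1 s powr a" using assms by (intro powr_mono2) auto
  also have "\<dots> \<le> max 1 s powr b" using assms by (intro powr_mono) auto
  finally show ?thesis .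
qed

lemma max_1_powr_le: "max 1 s powr b \<le> 1 + s powr b" for s b :: real
  by (cases "s \<le> 1") (auto simp: max_def)

text \<open>Applied with exponents p_j - 1 to bound \<open>Phi\<close> and with exponents p_j to
  bound the potential.\<close>

lemma sum_weighted_powr_le:
  fixes s q K :: real and u e :: "nat \<Rightarrow> real"
  assumes "s \<ge> 0" "K \<ge> 0" "\<And>j. j \<in> {1..l} \<Longrightarrow> u j \<le> K" "\<And>j. j \<in> {1..l} \<Longrightarrow> 0 \<le> e j \<and> e j \<le> q"
  shows "(\<Sum>j=1..l. u j * s powr e j) \<le> real l * K * max 1 s powr q"
proof -
  have "(\<Sum>j=1..l. u j * s powr e j) \<le> (\<Sum>j=1..l. K * max 1 s powr q)"
    using assms by (intro sum_mono mult_mono powr_le_max_1_powr) auto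
  then show ?thesis by simp
qed

text \<open>The growth of \<open>Phi\<close> has order p - 1, and (p - 1) p' = p. As t / (t - 1)
  decreases in t, the conjugate exponent is at most m / (m - 1), which makes the constant
  independent of the point.\<close>

lemma Phi_Psi_powr_conj_exponent_le:
  fixes l :: nat and ps :: "nat \<Rightarrow> 'a \<Rightarrow> real" and K m v :: real
  defines "p \<equiv> max_exponent l ps"
  assumes l: "l \<ge> 1" and K: "K \<ge> 1" and m: "1 < m" "m \<le> p x"
    and w: "\<And>j. j \<in> {1..l} \<Longrightarrow> 0 \<le> w j x \<and> w j x \<le> K"
    and ps: "\<And>j. j \<in> {1..l} \<Longrightarrow> ps j x > 1"
  shows "\<bar>Phi (Psi l w ps) x v\<bar> powr conj_exponent p x
           \<le> (real l * K) powr (m / (m - 1)) * (1 + \<bar>v\<bar> powr p x)"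
proof -
  have Q: "0 \<le> conj_exponent p x" "conj_exponent p x \<le> m / (m - 1)"
      "(p x - 1) * conj_exponent p x = p x"
    unfolding conj_exponent_def using m by (auto simp: field_simps)
  \<comment> \<open>A base of at least 1 is what allows its variable exponent to be replaced by the
    upper bound m / (m - 1).\<close>
  have lK: "real l * K \<ge> 1" using l K by (metis mult_mono of_nat_1 of_nat_le_iff zero_le_one mult_1 of_nat_0_le_iff)
  have "0 \<le> Phi (Psi l w ps) x v" unfolding Phi_Psi using w by (intro sum_nonneg) auto
  moreover have "Phi (Psi l w ps) x v \<le> real l * K * max 1 \<bar>v\<bar> powr (p x - 1)"
    unfolding Phi_Psi using w ps K max_exponent_ge[of _ l ps x]
    by (intro sum_weighted_powr_le) (auto simp: p_def less_imp_le)
  ultimately have "\<bar>Phi (Psi l w ps) x v\<bar> powr conj_exponent p x \<le>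
      (real l * K * max 1 \<bar>v\<bar> powr (p x - 1)) powr conj_exponent p x"
    using Q by (intro powr_mono2) auto
  also have "\<dots> = (real l * K) powr conj_exponent p x * max 1 \<bar>v\<bar> powr p x"
    using lK by (simp add: powr_mult powr_powr Q(3))
  also have "\<dots> \<le> (real l * K) powr (m / (m - 1)) * (1 + \<bar>v\<bar> powr p x)"
    using Q lK max_1_powr_le by (intro mult_mono powr_mono) auto
  finally show ?thesis .
qed

lemma potential_Psi_nonneg:
  assumes "\<And>j. j \<in> {1..l} \<Longrightarrow> 0 \<le> w j x" "\<And>j. j \<in> {1..l} \<Longrightarrow> ps j x > 1"
  shows "0 \<le> potential (Psi l w ps) x \<xi>"
proof -
  have "0 \<le> w j x * norm \<xi> powr ps j x / ps j x" if "j \<in> {1..l}" for j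
    using assms(1)[OF that] assms(2)[OF that] by simp
  then show ?thesis by (subst potential_Psi) (use assms(2) in \<open>auto intro: sum_nonneg\<close>)
qed

lemma potential_Psi_le:
  fixes K :: real
  assumes "K \<ge> 0" and w: "\<And>j. j \<in> {1..l} \<Longrightarrow> 0 \<le> w j x \<and> w j x \<le> K"
    and ps: "\<And>j. j \<in> {1..l} \<Longrightarrow> ps j x > 1"
  shows "potential (Psi l w ps) x \<xi> \<le> real l * K * (1 + norm \<xi> powr max_exponent l ps x)"
proof -
  \<comment> \<open>Dividing by an exponent above 1 only lowers the weight, so the quotients can
    serve as weights in \<open>sum_weighted_powr_le\<close>.\<close>
  have wp: "w j x / ps j x \<le> K" if "j \<in> {1..l}" for j
  proof -
    have "w j x / ps j x \<le> w j x / 1" using w[OF that] ps[OF that] by (intro divide_left_mono) auto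
    then show ?thesis using w[OF that] by simp
  qed
  have "potential (Psi l w ps) x \<xi> = (\<Sum>j=1..l. (w j x / ps j x) * norm \<xi> powr ps j x)"
    using potential_Psi[of l ps x w \<xi>] ps by simp
  also have "\<dots> \<le> real l * K * max 1 (norm \<xi>) powr max_exponent l ps x"
    using wp ps assms(1) max_exponent_ge[of _ l ps x]
    by (intro sum_weighted_powr_le) (auto intro: less_imp_le order.trans[OF zero_le_one])
  also have "\<dots> \<le> real l * K * (1 + norm \<xi> powr max_exponent l ps x)"
    using assms(1) max_1_powr_le by (intro mult_left_mono) auto
  finally show ?thesis .
qed

lemma potential_Psi_ge:
  assumes l: "l \<ge> 1" and "\<omega> > 0" and w: "\<And>j. j \<in> {1..l} \<Longrightarrow> \<omega> \<le> w j x"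
    and ps: "\<And>j. j \<in> {1..l} \<Longrightarrow> ps j x > 1" and M: "max_exponent l ps x \<le> M"
  shows "\<omega> / M * norm \<xi> powr max_exponent l ps x \<le> potential (Psi l w ps) x \<xi>"
proof -
  \<comment> \<open>The index \<open>k\<close> depends on the point, but the resulting constant
    \<omega> / M does not.\<close>
  obtain k where k: "k \<in> {1..l}" "max_exponent l ps x = ps k x"
    using l by (rule max_exponent_attained)
  have w0: "0 \<le> w j x" if "j \<in> {1..l}" for j using w[OF that] assms(2) by simp
  have "\<omega> / M \<le> w k x / ps k x"
    using k M w[OF k(1)] ps[OF k(1)] assms(2) by (intro frac_le) auto
  then have "\<omega> / M * norm \<xi> powr max_exponent l ps x \<le> w k x / ps k x * norm \<xi> powr ps k x"
    unfolding k(2) by (intro mult_right_mono) auto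
  also have "\<dots> = w k x * norm \<xi> powr ps k x / ps k x" by simp
  also have "\<dots> \<le> (\<Sum>j=1..l. w j x * norm \<xi> powr ps j x / ps j x)"
    using k w0 ps by (intro member_le_sum) (auto intro!: divide_nonneg_pos less_trans[OF zero_less_one])
  also have "\<dots> = potential (Psi l w ps) x \<xi>" using potential_Psi[of l ps x w \<xi>] ps by simp
  finally show ?thesis .
qed

section \<open>Essential bounds for the weights\<close>

lemma Linf_AE_bounded:
  assumes "u \<in> Linf \<Omega>"
  obtains K where "AE x in lebesgue_on \<Omega>. \<bar>u x\<bar> \<le> K"
proof -
  have "esssup (lebesgue_on \<Omega>) (\<lambda>x. ereal \<bar>u x\<bar>) < \<infinity>" using assms by (auto simp: Linf_def)
  then obtain K where "esssup (lebesgue_on \<Omega>) (\<lambda>x. ereal \<bar>u x\<bar>) < ereal K"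
    using ereal_dense3 less_PInf_Ex_of_nat by (metis ereal_dense2)
  moreover have "AE x in lebesgue_on \<Omega>. ereal \<bar>u x\<bar> \<le> esssup (lebesgue_on \<Omega>) (\<lambda>x. ereal \<bar>u x\<bar>)"
    by (rule esssup_AE)
  ultimately have "AE x in lebesgue_on \<Omega>. \<bar>u x\<bar> \<le> K"
    by (auto elim!: eventually_mono) (metis ereal_less_eq(3) less_imp_le order_trans)
  then show ?thesis by (rule that)
qed

lemma Linf_AE_uniformly_bounded:
  assumes "\<forall>j\<in>{1..l::nat}. w j \<in> Linf \<Omega>"
  obtains K :: real where "K \<ge> 1" "AE x in lebesgue_on \<Omega>. \<forall>j\<in>{1..l}. w j x \<le> K"
proof -
  have "\<exists>k. AE x in lebesgue_on \<Omega>. \<bar>w j x\<bar> \<le> k" if "j \<in> {1..l}" for j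
    using assms that Linf_AE_bounded by blast
  then obtain k where k: "\<And>j. j \<in> {1..l} \<Longrightarrow> AE x in lebesgue_on \<Omega>. \<bar>w j x\<bar> \<le> k j"
    by metis
  \<comment> \<open>The sum of absolute values dominates every single bound, and the summand 1
    ensures \<open>K \<ge> 1\<close>, as the estimate of \<open>Phi\<close> requires.\<close>
  define K where "K = 1 + (\<Sum>j=1..l. \<bar>k j\<bar>)"
  have le: "k j \<le> K" if "j \<in> {1..l}" for j
    using that member_le_sum[of j "{1..l}" "\<lambda>j. \<bar>k j\<bar>"] by (auto simp: K_def)
  have "AE x in lebesgue_on \<Omega>. \<forall>j\<in>{1..l}. w j x \<le> K"
  proof (rule AE_finite_allI)
    fix j assume j: "j \<in> {1..l}"
    show "AE x in lebesgue_on \<Omega>. w j x \<le> K"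
      using k[OF j] by eventually_elim (use le[OF j] in linarith)
  qed auto
  moreover have "K \<ge> 1" unfolding K_def by (simp add: sum_nonneg)
  ultimately show ?thesis using that by blast
qed

section \<open>Verification of the six properties on the domain\<close>

theorem proposition3p1:
  fixes \<Omega> :: "(real ^ 'n) set"
    and l :: nat
    and ps w :: "nat \<Rightarrow> real ^ 'n \<Rightarrow> real"
    and \<omega> :: real
  assumes N: "CARD('n) \<ge> 2"
    and dom: "bounded_lipschitz_domain \<Omega>"
    and l: "l \<ge> 1"
    and ps_gt_1: "\<forall>j\<in>{1..l}. \<forall>x\<in>closure \<Omega>. 1 < ps j x"
    and ps_reg:
      "(\<forall>j\<in>{1..l}. continuous_on (closure \<Omega>) (ps j)) \<and>
         lower_exponent \<Omega> (max_exponent l ps) > 2 * real CARD('n) / (real CARD('n) + 2)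
       \<or> (\<forall>j\<in>{1..l}. log_holder_on (closure \<Omega>) (ps j)) \<and>
         lower_exponent \<Omega> (max_exponent l ps) \<ge> 2 * real CARD('n) / (real CARD('n) + 2)"
    and w_Linf: "\<forall>j\<in>{1..l}. w j \<in> Linf \<Omega>"
    and \<omega>: "\<omega> > 0"
    and w_essinf: "Min ((\<lambda>j. essinf (lebesgue_on \<Omega>) (\<lambda>x. ereal (w j x))) ` {1..l}) \<ge> ereal \<omega>"
    and w_repr: "\<forall>j\<in>{1..l}. w j \<in> borel_measurable (lebesgue_on (closure \<Omega>)) \<and>
                            (\<forall>x\<in>closure \<Omega>. w j x \<ge> \<omega>)"
  shows
    "let p = max_exponent l ps; \<Psi> = Psi l w ps in
      \<comment> \<open>(i)\<close>
      ((\<forall>x\<in>closure \<Omega>. 1 < p x) \<and>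
       (log_holder_on (closure \<Omega>) p \<and>
          lower_exponent \<Omega> p \<ge> 2 * real CARD('n) / (real CARD('n) + 2)
        \<or> continuous_on (closure \<Omega>) p \<and>
          lower_exponent \<Omega> p > 2 * real CARD('n) / (real CARD('n) + 2))) \<and>
      \<comment> \<open>(ii)\<close>
      ((\<forall>x\<in>closure \<Omega>. \<forall>s>0. \<Psi> x s > 0) \<and>
       (\<forall>s>0. (\<lambda>x. \<Psi> x s) \<in> borel_measurable (lebesgue_on (closure \<Omega>))) \<and>
       (AE x in lebesgue_on \<Omega>. locally_abs_continuous_pos (\<Psi> x))) \<and>
      \<comment> \<open>(iii)\<close>
      (\<forall>x\<in>\<Omega>. ((\<lambda>s. \<Psi> x s * s) \<longlongrightarrow> 0) (at_right 0)) \<and>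
      \<comment> \<open>(iv)\<close>
      (AE x in lebesgue_on \<Omega>. strict_mono_on {0<..} (\<lambda>s. \<Psi> x s * s)) \<and>
      \<comment> \<open>(v)\<close>
      (\<forall>v\<in>Lvar \<Omega> p. (\<lambda>x. Phi \<Psi> x (v x)) \<in> Lvar \<Omega> (conj_exponent p)) \<and>
      \<comment> \<open>(vi)\<close>
      (\<exists>\<delta>>0. \<exists>\<delta>'\<ge>0. \<forall>v\<in>W1var \<Omega> p.
         integrable (lebesgue_on \<Omega>) (\<lambda>x. potential \<Psi> x (weak_grad \<Omega> v x)) \<and>
         (LINT x|lebesgue_on \<Omega>. potential \<Psi> x (weak_grad \<Omega> v x))
           \<ge> \<delta> * (LINT x|lebesgue_on \<Omega>. norm (weak_grad \<Omega> v x) powr p x) - \<delta>')"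
proof -
  define p where "p = max_exponent l ps"
  define \<Psi> where "\<Psi> = Psi l w ps"
  let ?M = "lebesgue_on \<Omega>"
  have "open \<Omega>" "bounded \<Omega>" "\<Omega> \<noteq> {}"
    using dom by (auto simp: bounded_lipschitz_domain_def)
  have cl: "x \<in> closure \<Omega>" if "x \<in> \<Omega>" for x using that closure_subset by blast
  have lm: "\<Omega> \<in> lmeasurable" "\<Omega> \<in> sets lebesgue" "closure \<Omega> \<in> sets lebesgue"
    using \<open>open \<Omega>\<close> \<open>bounded \<Omega>\<close> by (auto intro: lmeasurable_open)
  have ps1: "ps j x > 1" if "j \<in> {1..l}" "x \<in> closure \<Omega>" for j x using ps_gt_1 that by blast
  have w\<omega>: "w j x \<ge> \<omega>" if "j \<in> {1..l}" "x \<in> closure \<Omega>" for j x using w_repr that by blast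
  have w0: "w j x > 0" if "j \<in> {1..l}" "x \<in> closure \<Omega>" for j x using w\<omega>[OF that] \<omega> by simp

  have p1: "1 < p x" if "x \<in> closure \<Omega>" for x
    using max_exponent_attained[OF l, of ps x] ps1[OF _ that] unfolding p_def by metis
  have ps_cont: "continuous_on (closure \<Omega>) (ps j)" if "j \<in> {1..l}" for j
    using ps_reg that log_holder_on_imp_continuous_on by blast
  have p_cont: "continuous_on (closure \<Omega>) p"
    unfolding p_def by (rule max_exponent_closed[OF l]) (auto intro: continuous_on_max ps_cont)
  have i: "log_holder_on (closure \<Omega>) p \<and> lower_exponent \<Omega> p \<ge> 2 * real CARD('n) / (real CARD('n) + 2)
        \<or> continuous_on (closure \<Omega>) p \<and> lower_exponent \<Omega> p > 2 * real CARD('n) / (real CARD('n) + 2)"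
    using ps_reg p_cont max_exponent_closed[OF l, of "log_holder_on (closure \<Omega>)" ps]
    unfolding p_def using log_holder_on_max by blast

  have comp: "compact (closure \<Omega>)" "closure \<Omega> \<noteq> {}" using \<open>bounded \<Omega>\<close> \<open>\<Omega> \<noteq> {}\<close> by auto
  \<comment> \<open>Here \<open>p a\<close> > 1 is the minimum of p, the \<open>m\<close> of the
    estimate for \<open>Phi\<close>; \<open>p b\<close> below is the maximum, the \<open>M\<close>
    of the lower bound for the potential.\<close>
  obtain a where a: "a \<in> closure \<Omega>" "\<And>x. x \<in> closure \<Omega> \<Longrightarrow> p a \<le> p x"
    using continuous_attains_inf[OF comp p_cont] by blast
  obtain b where b: "b \<in> closure \<Omega>" "\<And>x. x \<in> closure \<Omega> \<Longrightarrow> p x \<le> p b"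
    using continuous_attains_sup[OF comp p_cont] by blast

  have ps_meas_cl: "ps j \<in> borel_measurable (lebesgue_on (closure \<Omega>))" if "j \<in> {1..l}" for j
    using ps_cont[OF that] lm by (intro continuous_imp_measurable_on_sets_lebesgue)
  have ps_meas: "ps j \<in> borel_measurable ?M" if "j \<in> {1..l}" for j
    using continuous_on_subset[OF ps_cont[OF that] closure_subset] lm
    by (intro continuous_imp_measurable_on_sets_lebesgue)
  have p_meas: "p \<in> borel_measurable ?M"
    using continuous_on_subset[OF p_cont closure_subset] lm
    by (intro continuous_imp_measurable_on_sets_lebesgue)
  have w_meas: "w j \<in> borel_measurable ?M" if "j \<in> {1..l}" for j
    using w_Linf that by (auto simp: Linf_def)
  have Psi_meas: "(\<lambda>x. \<Psi> x s) \<in> borel_measurable (lebesgue_on (closure \<Omega>))" for s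
    unfolding \<Psi>_def Psi_def using w_repr ps_meas_cl
    by (intro borel_measurable_sum borel_measurable_times powr_real_measurable) auto

  obtain K where K: "K \<ge> 1" "AE x in ?M. \<forall>j\<in>{1..l}. w j x \<le> K"
    using w_Linf by (rule Linf_AE_uniformly_bounded)
  \<comment> \<open>Finite measure makes the constant parts of the majorants in (v) and (vi)
    integrable.\<close>
  have finM: "finite_measure ?M" using lm(1) by (rule finite_measure_lebesgue_on)

  have v: "(\<lambda>x. Phi \<Psi> x (v x)) \<in> Lvar \<Omega> (conj_exponent p)" if "v \<in> Lvar \<Omega> p" for v
  proof -
    have v: "v \<in> borel_measurable ?M" "integrable ?M (\<lambda>x. \<bar>v x\<bar> powr p x)"
      using that by (auto simp: Lvar_def)
    have meas: "(\<lambda>x. Phi \<Psi> x (v x)) \<in> borel_measurable ?M"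
      unfolding \<Psi>_def Phi_Psi using w_meas ps_meas v
      by (intro borel_measurable_sum borel_measurable_times powr_real_measurable) auto
    have meas': "(\<lambda>x. \<bar>Phi \<Psi> x (v x)\<bar> powr conj_exponent p x) \<in> borel_measurable ?M"
      unfolding conj_exponent_def using meas p_meas by (intro powr_real_measurable) auto
    have "integrable ?M (\<lambda>x. (real l * K) powr (p a / (p a - 1)) * (1 + \<bar>v x\<bar> powr p x))"
      using v finite_measure.integrable_const[OF finM]
      by (intro integrable_mult_right Bochner_Integration.integrable_add) auto
    then have "integrable ?M (\<lambda>x. \<bar>Phi \<Psi> x (v x)\<bar> powr conj_exponent p x)"
    proof (rule Bochner_Integration.integrable_bound[OF _ meas'])
      \<comment> \<open>The bound by \<open>K\<close> holds only almost everywhere, while the sign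
        of the weights and the exponent bounds are known on the closure; membership in \<Omega>
        joins the two.\<close>
      have "AE x in ?M. x \<in> \<Omega>" by (rule AE_I2) simp
      with K(2) show "AE x in ?M. norm (\<bar>Phi \<Psi> x (v x)\<bar> powr conj_exponent p x) \<le>
          norm ((real l * K) powr (p a / (p a - 1)) * (1 + \<bar>v x\<bar> powr p x))"
      proof eventually_elim
        case (elim x)
        have "\<bar>Phi \<Psi> x (v x)\<bar> powr conj_exponent p x \<le>
            (real l * K) powr (p a / (p a - 1)) * (1 + \<bar>v x\<bar> powr p x)"
          unfolding \<Psi>_def p_def
          by (rule Phi_Psi_powr_conj_exponent_le)
             (use l K(1) elim a p1[OF a(1)] cl w0 ps1 in \<open>auto simp: p_def intro: less_imp_le\<close>)
        then show ?case by (simp add: abs_mult)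
      qed
    qed
    with meas show ?thesis by (simp add: Lvar_def)
  qed

  \<comment> \<open>Proved for any field whose norm lies in the variable exponent space;
    \<open>W1var\<close> supplies exactly this for the weak gradient.\<close>
  have vi: "integrable ?M (\<lambda>x. potential \<Psi> x (g x)) \<and>
      (LINT x|?M. potential \<Psi> x (g x)) \<ge> \<omega> / p b * (LINT x|?M. norm (g x) powr p x)"
    if g: "(\<lambda>x. norm (g x)) \<in> Lvar \<Omega> p" for g :: "real ^ 'n \<Rightarrow> real ^ 'n"
  proof
    have g: "(\<lambda>x. norm (g x)) \<in> borel_measurable ?M" "integrable ?M (\<lambda>x. norm (g x) powr p x)"
      using g by (auto simp: Lvar_def)
    have "(\<lambda>x. \<Sum>j=1..l. w j x * norm (g x) powr ps j x / ps j x) \<in> borel_measurable ?M"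
      using w_meas ps_meas g
      by (intro borel_measurable_sum borel_measurable_times borel_measurable_divide
          powr_real_measurable) auto
    \<comment> \<open>Only the norm of \<open>g\<close> is known to be measurable. That is enough,
      since on \<Omega>, where all exponents exceed 1, the potential equals a formula in the norm
      alone.\<close>
    moreover have "(\<Sum>j=1..l. w j x * norm (g x) powr ps j x / ps j x) = potential \<Psi> x (g x)"
      if "x \<in> space ?M" for x
      unfolding \<Psi>_def using that cl ps1 by (subst potential_Psi) auto
    ultimately have meas: "(\<lambda>x. potential \<Psi> x (g x)) \<in> borel_measurable ?M"
      by (subst (asm) measurable_cong)
    have "integrable ?M (\<lambda>x. real l * K * (1 + norm (g x) powr p x))"
      using g finite_measure.integrable_const[OF finM]
      by (intro integrable_mult_right Bochner_Integration.integrable_add) auto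
    then show int: "integrable ?M (\<lambda>x. potential \<Psi> x (g x))"
    proof (rule Bochner_Integration.integrable_bound[OF _ meas])
      have "AE x in ?M. x \<in> \<Omega>" by (rule AE_I2) simp
      with K(2) show "AE x in ?M. norm (potential \<Psi> x (g x)) \<le>
          norm (real l * K * (1 + norm (g x) powr p x))"
      proof eventually_elim
        case (elim x)
        have "0 \<le> potential \<Psi> x (g x)"
          unfolding \<Psi>_def using elim cl w0 ps1 by (intro potential_Psi_nonneg) (auto intro: less_imp_le)
        moreover have "potential \<Psi> x (g x) \<le> real l * K * (1 + norm (g x) powr p x)"
          unfolding \<Psi>_def p_def
          by (rule potential_Psi_le) (use K(1) elim cl w0 ps1 in \<open>auto intro: less_imp_le\<close>)
        ultimately show ?case by simp
      qed
    qed
    have "(LINT x|?M. \<omega> / p b * norm (g x) powr p x) \<le> (LINT x|?M. potential \<Psi> x (g x))"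
    proof (rule integral_mono[OF _ int])
      show "\<omega> / p b * norm (g x) powr p x \<le> potential \<Psi> x (g x)" if "x \<in> space ?M" for x
        unfolding \<Psi>_def p_def
        by (rule potential_Psi_ge) (use that l \<omega> cl w\<omega> ps1 b in \<open>auto simp: p_def\<close>)
    qed (use g in auto)
    then show "\<omega> / p b * (LINT x|?M. norm (g x) powr p x) \<le> (LINT x|?M. potential \<Psi> x (g x))"
      by simp
  qed
  have vi': "\<exists>\<delta>>0. \<exists>\<delta>'\<ge>0. \<forall>v\<in>W1var \<Omega> p.
         integrable ?M (\<lambda>x. potential \<Psi> x (weak_grad \<Omega> v x)) \<and>
         (LINT x|?M. potential \<Psi> x (weak_grad \<Omega> v x))
           \<ge> \<delta> * (LINT x|?M. norm (weak_grad \<Omega> v x) powr p x) - \<delta>'"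
    using \<omega> p1[OF b(1)] vi by (intro exI[of _ "\<omega> / p b"] conjI exI[of _ 0]) (auto simp: W1var_def)

  have AC: "AE x in ?M. locally_abs_continuous_pos (\<Psi> x)"
    unfolding \<Psi>_def by (simp add: locally_abs_continuous_pos_Psi)
  have mono: "AE x in ?M. strict_mono_on {0<..} (\<lambda>s. \<Psi> x s * s)"
    unfolding \<Psi>_def using l cl w0 ps1 by (intro AE_I2 strict_mono_on_Psi_times) auto
  have pos: "\<Psi> x s > 0" if "x \<in> closure \<Omega>" "s > 0" for x s
    unfolding \<Psi>_def using l w0 that by (intro Psi_pos) auto
  have lim: "((\<lambda>s. \<Psi> x s * s) \<longlongrightarrow> 0) (at_right 0)" if "x \<in> \<Omega>" for x
    unfolding \<Psi>_def using ps1 cl[OF that] by (intro Psi_times_tendsto_0) auto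
  show ?thesis
    unfolding Let_def p_def[symmetric] \<Psi>_def[symmetric]
    by (intro conjI ballI allI impI) (rule p1 i pos Psi_meas AC lim mono v vi' | assumption)+
qed

end
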